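(* Let $n\ge 4$ and let $S=\{1+2^4m_4+\cdots+2^{n-1}m_{n-1},\ 16+2^4m_4+\cdots+2^{n-1}m_{n-1} : m_k\in\{0,1\}\}$. For $u\in S$ let $v=2^n+1-u$. For each of the following systems — the $n$-cube, the switched $n$-cube, any partially switched $n$-cube, any weighted graph whose adjacency matrix is one of the convex combinations described in the context, and any time-switched system as described in the context — consider the fidelity $p(t)$ of state transfer between $u$ and $v$ as a function of the readout time $t$. Then all these systems have perfect state transfer between $u$ and $v$ at $t=\pi/2$, and for every $k\ge1$ the $k$-th derivative $\frac{d^kp}{dt^k}\big|_{t=\pi/2}$ is the same for all of these systems.
   Context: For $m\ge 0$ let $C_m$ be the $2^m\times 2^m$ adjacency matrix of the $m$-cube with vertices $1,\dots,2^m$, $a\sim b$ iff the binary representations of $a-1$ and $b-1$ differ in exactly one bit. Let $A_{4,1}$ be the adjacency matrix of the 4-cube on $\{1,\dots,16\}$ with edges $\{1,2\},\{1,3\},\{1,4\},\{1,5\}$; $\{2,6\},\{2,7\},\{2,9\},\{3,6\},\{3,8\},\{3,10\},\{4,7\},\{4,8\},\{4,11\},\{5,9\},\{5,10\},\{5,11\}$; $\{6,12\},\{6,13\},\{7,12\},\{7,14\},\{8,12\},\{8,15\},\{9,13\},\{9,14\},\{10,13\},\{10,15\},\{11,14\},\{11,15\}$; $\{12,16\},\{13,16\},\{14,16\},\{15,16\}$. Let $A_{4,2}$ be the adjacency matrix of the switched 4-cube: same edges except the twelve edges between $\{2,3,4,5\}$ and $\{6,\dots,11\}$ are replaced by $\{2,8\},\{2,10\},\{2,11\},\{3,7\},\{3,9\},\{3,11\},\{4,6\},\{4,9\},\{4,10\},\{5,6\},\{5,7\},\{5,8\}$.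 The $n$-cube has adjacency matrix $C_{n-4}\otimes I_{16}+I_{2^{n-4}}\otimes A_{4,1}$; the switched $n$-cube $C_{n-4}\otimes I_{16}+I_{2^{n-4}}\otimes A_{4,2}$; a partially switched $n$-cube $\mathrm{diag}(B_1,\dots,B_{2^{n-4}})+C_{n-4}\otimes I_{16}$ with each $B_i\in\{A_{4,1},A_{4,2}\}$, some but not all equal to $A_{4,2}$. The convex combinations considered are convex combinations of any of these matrices and of matrices $\mathrm{diag}(M_1,\dots,M_{2^{n-4}})+C_{n-4}\otimes I_{16}$ with $M_j=p_jA_{4,1}+(1-p_j)A_{4,2}$, $0\le p_j\le 1$. For a time-independent system with adjacency (Hamiltonian) matrix $A$, $p(t)=|\langle u|e^{itA}|v\rangle|^2$. A time-switched system is given by times $0=t_0\le t_1\le\cdots\le t_{r-1}<\pi/2$ and matrices $A_1,\dots,A_r$, each the adjacency matrix of one of the graphs above; its fidelity for $t\ge t_{r-1}$ is $p(t)=|\langle u|e^{it_1A_1}e^{i(t_2-t_1)A_2}\cdots e^{i(t-t_{r-1})A_r}|v\rangle|^2$. $|j\rangle$ is the $j$-th standard basis vector, and PST between $u,v$ at $t_0$ means $p(t_0)=1$. *)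

theory Defs
  imports "HOL-Analysis.Analysis" "Jordan_Normal_Form.Matrix"
begin

text \<open>
  Matrices and vectors are those of \<^theory>\<open>Jordan_Normal_Form.Matrix\<close>, which are indexed from 0.
  Vertices are numbered from 1, so that vertex \<open>j\<close> is row, column and coordinate \<open>j - 1\<close>.
\<close>

definition cube_adj :: "nat \<Rightarrow> real mat" where
  "cube_adj m = mat (2 ^ m) (2 ^ m)
     (\<lambda>(a, b). if card {k. bit a k \<noteq> bit b k} = 1 then 1 else 0)"

definition adj_of_edges :: "nat \<Rightarrow> nat set set \<Rightarrow> real mat" where
  "adj_of_edges N E = mat N N (\<lambda>(i, j). if {i + 1, j + 1} \<in> E then 1 else 0)"

definition outer_edges :: "nat set set" where
  "outer_edges =
    {{1,2}, {1,3}, {1,4}, {1,5},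
     {6,12}, {6,13}, {7,12}, {7,14}, {8,12}, {8,15},
     {9,13}, {9,14}, {10,13}, {10,15}, {11,14}, {11,15},
     {12,16}, {13,16}, {14,16}, {15,16}}"

definition A41 :: "real mat" where
  "A41 = adj_of_edges 16 (outer_edges \<union>
    {{2,6}, {2,7}, {2,9}, {3,6}, {3,8}, {3,10},
     {4,7}, {4,8}, {4,11}, {5,9}, {5,10}, {5,11}})"

definition A42 :: "real mat" where
  "A42 = adj_of_edges 16 (outer_edges \<union>
    {{2,8}, {2,10}, {2,11}, {3,7}, {3,9}, {3,11},
     {4,6}, {4,9}, {4,10}, {5,6}, {5,7}, {5,8}})"

definition kron :: "'a::semiring_0 mat \<Rightarrow> 'a mat \<Rightarrow> 'a mat" (infixl \<open>\<otimes>\<^sub>K\<close> 72) where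
  "A \<otimes>\<^sub>K B = mat (dim_row A * dim_row B) (dim_col A * dim_col B)
     (\<lambda>(i, j). A $$ (i div dim_row B, j div dim_col B) * B $$ (i mod dim_row B, j mod dim_col B))"

definition n_cube :: "nat \<Rightarrow> real mat" where
  "n_cube n = cube_adj (n - 4) \<otimes>\<^sub>K 1\<^sub>m 16 + 1\<^sub>m (2 ^ (n - 4)) \<otimes>\<^sub>K A41"

definition switched_n_cube :: "nat \<Rightarrow> real mat" where
  "switched_n_cube n = cube_adj (n - 4) \<otimes>\<^sub>K 1\<^sub>m 16 + 1\<^sub>m (2 ^ (n - 4)) \<otimes>\<^sub>K A42"

definition partially_switched_n_cubes :: "nat \<Rightarrow> real mat set" where
  "partially_switched_n_cubes n =
    {diag_block_mat Bs + cube_adj (n - 4) \<otimes>\<^sub>K 1\<^sub>m 16 | Bs.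
       length Bs = 2 ^ (n - 4) \<and> set Bs \<subseteq> {A41, A42} \<and>
       (\<exists>B \<in> set Bs. B = A42) \<and> \<not> (\<forall>B \<in> set Bs. B = A42)}"

definition blockwise_mixed_n_cubes :: "nat \<Rightarrow> real mat set" where
  "blockwise_mixed_n_cubes n =
    {diag_block_mat (map (\<lambda>p. p \<cdot>\<^sub>m A41 + (1 - p) \<cdot>\<^sub>m A42) ps) + cube_adj (n - 4) \<otimes>\<^sub>K 1\<^sub>m 16 | ps.
       length ps = 2 ^ (n - 4) \<and> set ps \<subseteq> {0..1}}"

text \<open>The type of matrices is not a real vector space, so \<^const>\<open>convex\<close> and \<open>convex hull\<close> do not apply.\<close>

definition convex_combinations :: "nat \<Rightarrow> real mat set \<Rightarrow> real mat set" where
  "convex_combinations N \<X> =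
    {mat N N (\<lambda>ij. \<Sum>k<m. c k * X k $$ ij) | (m::nat) c X.
       (\<forall>k<m. 0 \<le> c k \<and> X k \<in> \<X>) \<and> (\<Sum>k<m. c k) = 1}"

definition n_cube_graphs :: "nat \<Rightarrow> real mat set" where
  "n_cube_graphs n = {n_cube n, switched_n_cube n} \<union> partially_switched_n_cubes n"

definition weighted_n_cube_graphs :: "nat \<Rightarrow> real mat set" where
  "weighted_n_cube_graphs n =
     convex_combinations (2 ^ n) (n_cube_graphs n \<union> blockwise_mixed_n_cubes n)"

definition all_n_cube_graphs :: "nat \<Rightarrow> real mat set" where
  "all_n_cube_graphs n = n_cube_graphs n \<union> weighted_n_cube_graphs n"

definition mat_exp :: "complex mat \<Rightarrow> complex mat" where
  "mat_exp M = mat (dim_row M) (dim_row M) (\<lambda>ij. \<Sum>k. (M ^\<^sub>m k) $$ ij / fact k)"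

definition evolution :: "real mat \<Rightarrow> real \<Rightarrow> complex mat" where
  "evolution A t = mat_exp ((\<i> * complex_of_real t) \<cdot>\<^sub>m map_mat complex_of_real A)"

definition ket :: "nat \<Rightarrow> nat \<Rightarrow> complex vec" where
  "ket N j = unit_vec N (j - 1)"

text \<open>The product \<open>\<bullet>c\<close> conjugates its second argument, so the bra goes on the right.\<close>

definition transfer_prob :: "complex mat \<Rightarrow> nat \<Rightarrow> nat \<Rightarrow> real" where
  "transfer_prob U u v =
     (cmod ((U *\<^sub>v ket (dim_col U) v) \<bullet>c ket (dim_row U) u))\<^sup>2"

definition fidelity :: "real mat \<Rightarrow> nat \<Rightarrow> nat \<Rightarrow> real \<Rightarrow> real" where
  "fidelity A u v t = transfer_prob (evolution A t) u v"

text \<open>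
  For \<open>ts = [t\<^sub>0, \<dots>, t\<^bsub>r-1\<^esub>]\<close> and \<open>As = [A\<^sub>1, \<dots>, A\<^sub>r]\<close>, the matrix \<open>A\<^sub>k\<close> acts during \<open>[t\<^bsub>k-1\<^esub>, t\<^sub>k]\<close>,
  and \<open>A\<^sub>r\<close> acts from \<open>t\<^bsub>r-1\<^esub>\<close> to the readout time \<open>t\<close>.  The result is the fidelity only for
  \<open>t \<ge> t\<^bsub>r-1\<^esub>\<close>, which includes a neighbourhood of \<open>\<pi>/2\<close> whenever \<open>t\<^bsub>r-1\<^esub> < \<pi>/2\<close>.
\<close>

definition switched_evolution :: "nat \<Rightarrow> real list \<Rightarrow> real mat list \<Rightarrow> real \<Rightarrow> complex mat" where
  "switched_evolution N ts As t =
     foldr (*) (map2 evolution As (map2 (-) (tl ts @ [t]) ts)) (1\<^sub>m N)"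

definition switched_fidelity ::
    "nat \<Rightarrow> real list \<Rightarrow> real mat list \<Rightarrow> nat \<Rightarrow> nat \<Rightarrow> real \<Rightarrow> real" where
  "switched_fidelity N ts As u v t = transfer_prob (switched_evolution N ts As t) u v"

definition switching_schedule :: "nat \<Rightarrow> real list \<Rightarrow> real mat list \<Rightarrow> bool" where
  "switching_schedule n ts As \<longleftrightarrow>
     ts \<noteq> [] \<and> length As = length ts \<and> hd ts = 0 \<and> sorted ts \<and> last ts < pi / 2 \<and>
     set As \<subseteq> all_n_cube_graphs n"

definition system_fidelities :: "nat \<Rightarrow> nat \<Rightarrow> nat \<Rightarrow> (real \<Rightarrow> real) set" where
  "system_fidelities n u v =
     {fidelity A u v | A. A \<in> all_n_cube_graphs n} \<union>
     {switched_fidelity (2 ^ n) ts As u v | ts As. switching_schedule n ts As}"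

definition S :: "nat \<Rightarrow> nat set" where
  "S n = {a + (\<Sum>k = 4..<n. 2 ^ k * m k) | a m. a \<in> {1, 16} \<and> (\<forall>k. m k \<in> {0, 1})}"

definition smooth_at :: "(real \<Rightarrow> real) \<Rightarrow> real \<Rightarrow> bool" where
  "smooth_at p x \<longleftrightarrow> (\<forall>k. \<forall>\<^sub>F t in nhds x. (deriv ^^ k) p differentiable (at t))"

end

theory Submission
  imports Defs "HOL-Complex_Analysis.Cauchy_Integral_Formula"
begin

text \<open>
  Let \<open>W\<close> be the span of the vectors \<open>e\<^sub>b \<otimes> 1\<^sub>\<ell>\<close>, where \<open>1\<^sub>\<ell>\<close> is the indicator of the vertices of the
  4-cube at distance \<open>\<ell>\<close> from vertex 1.  Switching replaces the edges between levels 1 and 2 by their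
  bipartite complement, which has the same degrees on both sides, so \<open>A\<^sub>4\<^sub>,\<^sub>1\<close> and \<open>A\<^sub>4\<^sub>,\<^sub>2\<close> agree on the level
  vectors.  Hence all the matrices considered preserve \<open>W\<close> and coincide there.  Since \<open>W\<close> contains the
  initial state, every system, time-switched or not, follows the trajectory of the \<open>n\<close>-cube, in which
  the \<open>n\<close> bits evolve independently; so each fidelity is \<open>sin\<^sup>2\<^sup>n t\<close> for all \<open>t\<close>.

  The trajectory is written down explicitly as a solution of \<open>\<phi>' = \<i> A \<phi>\<close> and identified with the matrix
  exponential by expanding its coordinates, which are entire, in power series.
\<close>

unbundle no vec_syntax

section \<open>The matrix exponential and linear flows\<close>

lemma mat_exp_carrier: "M \<in> carrier_mat N N \<Longrightarrow> mat_exp M \<in> carrier_mat N N"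
  by (simp add: mat_exp_def)

lemma evolution_carrier: "A \<in> carrier_mat N N \<Longrightarrow> evolution A t \<in> carrier_mat N N"
  unfolding evolution_def by (intro mat_exp_carrier) simp

lemma index_mult_mat_vec_sum:
  assumes "M \<in> carrier_mat N N" "w \<in> carrier_vec N" "i < N"
  shows "(M *\<^sub>v w) $ i = (\<Sum>j<N. M $$ (i, j) * w $ j)"
  using assms by (simp add: scalar_prod_def atLeast0LessThan)

text \<open>An entry of a product is a sum of \<open>N\<close> terms, each at most the inductive
  bound times \<open>c\<close>. The estimate is crude, but it dominates the exponential series
  entrywise.\<close>

lemma norm_pow_mat_entry_le:
  fixes M :: "complex mat"
  assumes M: "M \<in> carrier_mat N N" and c: "\<And>i j. i < N \<Longrightarrow> j < N \<Longrightarrow> norm (M $$ (i, j)) \<le> c"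
    and "i < N" "j < N"
  shows "norm ((M ^\<^sub>m k) $$ (i, j)) \<le> (real N * c) ^ k"
  using assms(3,4)
proof (induction k arbitrary: j)
  case 0
  then show ?case using M by simp
next
  case (Suc k)
  have c0: "0 \<le> c" using c[OF Suc.prems(1,1)] norm_ge_zero order_trans by blast
  have "(M ^\<^sub>m Suc k) $$ (i, j) = (\<Sum>l<N. (M ^\<^sub>m k) $$ (i, l) * M $$ (l, j))"
    using Suc.prems M pow_carrier_mat[OF M, of k]
    by (simp add: scalar_prod_def atLeast0LessThan)
  also have "norm \<dots> \<le> (\<Sum>l<N. (real N * c) ^ k * c)"
    using Suc.IH Suc.prems c c0
    by (intro sum_norm_le) (auto simp: norm_mult intro!: mult_mono)
  finally show ?case by (simp add: mult_ac)
qed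

lemma summable_mat_exp_entry:
  fixes M :: "complex mat"
  assumes M: "M \<in> carrier_mat N N" and "i < N" "j < N"
  shows "summable (\<lambda>k. (M ^\<^sub>m k) $$ (i, j) / fact k)"
proof -
  \<comment> \<open>The sum of the norms of all entries, a convenient uniform bound for each of
    them.\<close>
  define c where "c = (\<Sum>i<N. \<Sum>j<N. norm (M $$ (i, j)))"
  have c: "norm (M $$ (i, j)) \<le> c" if "i < N" "j < N" for i j
  proof -
    have "norm (M $$ (i, j)) \<le> (\<Sum>j<N. norm (M $$ (i, j)))"
      using that by (intro member_le_sum) auto
    also have "\<dots> \<le> c"
      unfolding c_def using that
      by (intro member_le_sum[where f = "\<lambda>i. \<Sum>j<N. norm (M $$ (i, j))"]) (auto intro: sum_nonneg)
    finally show ?thesis .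
  qed
  show ?thesis
  proof (rule summable_comparison_test')
    show "summable (\<lambda>k. inverse (fact k) * (real N * c) ^ k)"
      by (rule summable_exp)
    show "norm ((M ^\<^sub>m k) $$ (i, j) / fact k) \<le> inverse (fact k) * (real N * c) ^ k" for k
      using norm_pow_mat_entry_le[OF M c assms(2,3), of k]
      by (simp add: norm_divide field_simps)
  qed
qed

lemma mat_exp_mult_vec_sums:
  assumes M: "M \<in> carrier_mat N N" and w: "w \<in> carrier_vec N" and i: "i < N"
  shows "(\<lambda>k. ((M ^\<^sub>m k) *\<^sub>v w) $ i / fact k) sums (mat_exp M *\<^sub>v w) $ i"
proof -
  have "(\<lambda>k. \<Sum>j<N. (M ^\<^sub>m k) $$ (i, j) / fact k * w $ j) sums
      (\<Sum>j<N. (\<Sum>k. (M ^\<^sub>m k) $$ (i, j) / fact k) * w $ j)"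
    using M i by (intro sums_sum sums_mult2 summable_sums summable_mat_exp_entry) auto
  also have "(\<Sum>j<N. (\<Sum>k. (M ^\<^sub>m k) $$ (i, j) / fact k) * w $ j) = (mat_exp M *\<^sub>v w) $ i"
    using M i by (subst index_mult_mat_vec_sum[OF mat_exp_carrier[OF M] w i])
      (simp add: mat_exp_def)
  finally show ?thesis
    using i by (simp add: index_mult_mat_vec_sum[OF pow_carrier_mat[OF M] w] sum_divide_distrib)
qed

text \<open>The flow is linear with constant \<open>M\<close>, so each differentiation applies
  \<open>M\<close> once more. At 0 this yields the coefficients of the exponential series applied to
  \<open>\<psi> 0\<close>.\<close>

lemma higher_deriv_linear_flow:
  fixes \<psi> :: "complex \<Rightarrow> complex vec"
  assumes M: "M \<in> carrier_mat N N" and \<psi>: "\<And>z. \<psi> z \<in> carrier_vec N"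
    and deriv: "\<And>z i. i < N \<Longrightarrow> ((\<lambda>z. \<psi> z $ i) has_field_derivative (M *\<^sub>v \<psi> z) $ i) (at z)"
    and i: "i < N"
  shows "(deriv ^^ k) (\<lambda>z. \<psi> z $ i) = (\<lambda>z. ((M ^\<^sub>m k) *\<^sub>v \<psi> z) $ i)"
proof (induction k)
  case 0
  have "1\<^sub>m N *\<^sub>v \<psi> z = \<psi> z" for z using \<psi> by simp
  then show ?case using M by simp
next
  case (Suc k)
  note Mk = pow_carrier_mat[OF M, of k]
  have "((\<lambda>z. ((M ^\<^sub>m k) *\<^sub>v \<psi> z) $ i) has_field_derivative ((M ^\<^sub>m Suc k) *\<^sub>v \<psi> z) $ i) (at z)" for z
  proof -
    have "((\<lambda>z. \<Sum>j<N. (M ^\<^sub>m k) $$ (i, j) * \<psi> z $ j) has_field_derivative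
        (\<Sum>j<N. (M ^\<^sub>m k) $$ (i, j) * (M *\<^sub>v \<psi> z) $ j)) (at z)"
      by (intro DERIV_sum DERIV_cmult deriv) simp
    moreover have "(\<Sum>j<N. (M ^\<^sub>m k) $$ (i, j) * (M *\<^sub>v \<psi> z) $ j) = ((M ^\<^sub>m Suc k) *\<^sub>v \<psi> z) $ i"
      using index_mult_mat_vec_sum[OF Mk mult_mat_vec_carrier[OF M \<psi>] i]
        assoc_mult_mat_vec[OF Mk M \<psi>] by simp
    ultimately show ?thesis
      using i by (simp add: index_mult_mat_vec_sum[OF Mk \<psi>])
  qed
  then show ?case using Suc.IH by (auto intro: DERIV_imp_deriv)
qed

text \<open>Each coordinate is entire, so its Taylor series at 0 can be evaluated at 1, and that
  series is the exponential series. No uniqueness theorem for differential equations enters.\<close>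

lemma mat_exp_linear_flow:
  fixes \<psi> :: "complex \<Rightarrow> complex vec"
  assumes M: "M \<in> carrier_mat N N" and \<psi>: "\<And>z. \<psi> z \<in> carrier_vec N"
    and deriv: "\<And>z i. i < N \<Longrightarrow> ((\<lambda>z. \<psi> z $ i) has_field_derivative (M *\<^sub>v \<psi> z) $ i) (at z)"
  shows "mat_exp M *\<^sub>v \<psi> 0 = \<psi> 1"
proof
  show "dim_vec (mat_exp M *\<^sub>v \<psi> 0) = dim_vec (\<psi> 1)"
    using \<psi>[of 1] mat_exp_carrier[OF M] by simp
  fix i assume "i < dim_vec (\<psi> 1)"
  then have i: "i < N" using \<psi>[of 1] by simp
  \<comment> \<open>Any radius above 1 serves, since the series is evaluated at 1.\<close>
  have "(\<lambda>z. \<psi> z $ i) holomorphic_on ball 0 2"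
    using deriv[OF i] by (meson field_differentiable_at_within field_differentiable_def holomorphic_onI)
  from holomorphic_power_series[OF this, of 1]
  have "(\<lambda>k. ((M ^\<^sub>m k) *\<^sub>v \<psi> 0) $ i / fact k) sums \<psi> 1 $ i"
    by (simp add: higher_deriv_linear_flow[OF assms i])
  then show "(mat_exp M *\<^sub>v \<psi> 0) $ i = \<psi> 1 $ i"
    using mat_exp_mult_vec_sums[OF M \<psi> i] sums_unique2 by blast
qed

section \<open>Solutions of the Schrodinger equation and time-switched evolution\<close>

text \<open>The equation \<open>\<phi>' = \<i> A \<phi>\<close> solved for \<open>A \<phi>\<close>:
  the right side does not mention \<open>A\<close>, which makes the condition affine in
  \<open>A\<close> for fixed \<open>\<phi>\<close>. As \<open>deriv\<close> is total,
  differentiability is supplied separately by the holomorphy assumptions of the lemmas on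
  evolution.\<close>

definition schrodinger_solution :: "nat \<Rightarrow> (complex \<Rightarrow> complex vec) \<Rightarrow> real mat \<Rightarrow> bool" where
  "schrodinger_solution N \<phi> A \<longleftrightarrow> A \<in> carrier_mat N N \<and>
     (\<forall>z. \<forall>i<N. (\<Sum>j<N. of_real (A $$ (i, j)) * \<phi> z $ j) = - \<i> * deriv (\<lambda>z. \<phi> z $ i) z)"

text \<open>The segment from \<open>s\<close> to \<open>s + t\<close> is run through in unit
  parameter time: \<open>\<lambda>z. \<phi> (s + z * t)\<close> is a flow of
  \<open>\<i> t A\<close>, whose exponential carries parameter 0 to parameter 1.\<close>

lemma evolution_schrodinger_solution:
  fixes s t :: real
  assumes A: "schrodinger_solution N \<phi> A" and \<phi>: "\<And>z. \<phi> z \<in> carrier_vec N"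
    and hol: "\<And>i. i < N \<Longrightarrow> (\<lambda>z. \<phi> z $ i) holomorphic_on UNIV"
  shows "evolution A t *\<^sub>v \<phi> (of_real s) = \<phi> (of_real (s + t))"
proof -
  define M where "M = (\<i> * complex_of_real t) \<cdot>\<^sub>m map_mat complex_of_real A"
  have Ac: "A \<in> carrier_mat N N" using A by (simp add: schrodinger_solution_def)
  then have M: "M \<in> carrier_mat N N" by (simp add: M_def)
  have "((\<lambda>z. \<phi> (s + z * t) $ i) has_field_derivative (M *\<^sub>v \<phi> (s + z * t)) $ i) (at z)"
    if i: "i < N" for z :: complex and i
  proof -
    have "((\<lambda>z. \<phi> z $ i) has_field_derivative deriv (\<lambda>z. \<phi> z $ i) (s + z * t)) (at (s + z * t))"
      using hol[OF i] by (simp add: holomorphic_derivI)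
    then have "((\<lambda>z. \<phi> (s + z * t) $ i) has_field_derivative
        deriv (\<lambda>z. \<phi> z $ i) (s + z * t) * t) (at z)"
      by (rule DERIV_chain2[where f = "\<lambda>z. \<phi> z $ i" and g = "\<lambda>z. s + z * t"])
        (auto intro!: derivative_eq_intros)
    moreover have "(M *\<^sub>v \<phi> (s + z * t)) $ i =
        \<i> * t * (\<Sum>j<N. of_real (A $$ (i, j)) * \<phi> (s + z * t) $ j)"
      unfolding index_mult_mat_vec_sum[OF M \<phi> i] sum_distrib_left
      using Ac i by (intro sum.cong) (simp_all add: M_def)
    moreover have "(\<Sum>j<N. of_real (A $$ (i, j)) * \<phi> (s + z * t) $ j) =
        - \<i> * deriv (\<lambda>z. \<phi> z $ i) (s + z * t)"
      using A i by (simp add: schrodinger_solution_def)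
    moreover have "\<i> * t * (- \<i> * d) = d * t" for d
      by (simp add: algebra_simps)
    ultimately show ?thesis by simp
  qed
  from mat_exp_linear_flow[OF M _ this] \<phi> show ?thesis
    by (simp add: evolution_def M_def)
qed

lemma switched_evolution_carrier:
  assumes "\<forall>A \<in> set As. A \<in> carrier_mat N N"
  shows "switched_evolution N ts As t \<in> carrier_mat N N"
proof -
  have foldr: "foldr (*) Us (1\<^sub>m N) \<in> carrier_mat N N"
    if "\<forall>U \<in> set Us. U \<in> carrier_mat N N" for Us :: "complex mat list"
    using that by (induction Us) auto
  show ?thesis
    unfolding switched_evolution_def using assms
    by (intro foldr) (auto dest!: set_zip_leftD intro!: evolution_carrier)
qed

text \<open>All the matrices share the solution \<open>\<phi>\<close>, so each factor only advances
  its argument by its own duration, and the durations telescope. The induction peels off the first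
  matrix, which is the last to act on the vector.\<close>

lemma switched_evolution_schrodinger_solution:
  fixes s t :: real
  assumes As: "\<forall>A \<in> set As. schrodinger_solution N \<phi> A" and \<phi>: "\<And>z. \<phi> z \<in> carrier_vec N"
    and hol: "\<And>i. i < N \<Longrightarrow> (\<lambda>z. \<phi> z $ i) holomorphic_on UNIV"
    and "length As = length ts" "ts \<noteq> []"
  shows "switched_evolution N ts As t *\<^sub>v \<phi> (of_real s) = \<phi> (of_real (s + (t - hd ts)))"
  using assms(4,5) As
proof (induction As ts rule: list_induct2)
  case Nil
  then show ?case by simp
next
  case (Cons A As r ts)
  have A: "schrodinger_solution N \<phi> A" using Cons.prems by simp
  then have Ac: "A \<in> carrier_mat N N" by (simp add: schrodinger_solution_def)
  show ?case
  proof (cases ts)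
    case Nil
    then have "switched_evolution N (r # ts) (A # As) t = evolution A (t - r)"
      using Cons.hyps right_mult_one_mat[OF evolution_carrier[OF Ac]]
      by (simp add: switched_evolution_def)
    then show ?thesis
      using evolution_schrodinger_solution[OF A \<phi> hol] by simp
  next
    case (Cons r' ts')
    let ?U = "switched_evolution N ts As t"
    have U: "?U \<in> carrier_mat N N"
      using Cons.prems by (intro switched_evolution_carrier) (simp add: schrodinger_solution_def)
    have "switched_evolution N (r # ts) (A # As) t = evolution A (r' - r) * ?U"
      using Cons by (simp add: switched_evolution_def)
    then have "switched_evolution N (r # ts) (A # As) t *\<^sub>v \<phi> s =
        evolution A (r' - r) *\<^sub>v (?U *\<^sub>v \<phi> s)"
      using assoc_mult_mat_vec[OF evolution_carrier[OF Ac] U \<phi>] by simp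
    also have "?U *\<^sub>v \<phi> s = \<phi> (of_real (s + (t - r')))"
      using Cons Cons.IH Cons.prems by simp
    also have "evolution A (r' - r) *\<^sub>v \<dots> = \<phi> (of_real (s + (t - r') + (r' - r)))"
      by (rule evolution_schrodinger_solution[OF A \<phi> hol])
    finally show ?thesis by simp
  qed
qed

text \<open>Every matrix in the family sends \<open>\<phi> z\<close> to the same vector, and an
  average with weights of sum 1 does so too.\<close>

lemma schrodinger_solution_convex_combination:
  assumes \<X>: "\<forall>A \<in> \<X>. schrodinger_solution N \<phi> A" and B: "B \<in> convex_combinations N \<X>"
  shows "schrodinger_solution N \<phi> B"
proof -
  obtain m :: nat and c X where Bdef: "B = mat N N (\<lambda>ij. \<Sum>k<m. c k * X k $$ ij)"
    and X: "\<And>k. k < m \<Longrightarrow> X k \<in> \<X>" and c: "(\<Sum>k<m. c k) = 1"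
    using B unfolding convex_combinations_def by blast
  have "(\<Sum>j<N. of_real (B $$ (i, j)) * \<phi> z $ j) = - \<i> * deriv (\<lambda>z. \<phi> z $ i) z" if i: "i < N" for z i
  proof -
    have "(\<Sum>j<N. of_real (B $$ (i, j)) * \<phi> z $ j) =
        (\<Sum>j<N. \<Sum>k<m. of_real (c k) * (of_real (X k $$ (i, j)) * \<phi> z $ j))"
      using i by (intro sum.cong) (simp_all add: Bdef sum_distrib_right mult.assoc)
    also have "\<dots> = (\<Sum>k<m. of_real (c k) * (\<Sum>j<N. of_real (X k $$ (i, j)) * \<phi> z $ j))"
      by (subst sum.swap) (simp add: sum_distrib_left)
    also have "\<dots> = (\<Sum>k<m. of_real (c k) * (- \<i> * deriv (\<lambda>z. \<phi> z $ i) z))"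
      using \<X> X i by (intro sum.cong) (auto simp: schrodinger_solution_def)
    also have "\<dots> = of_real (\<Sum>k<m. c k) * (- \<i> * deriv (\<lambda>z. \<phi> z $ i) z)"
      by (simp only: sum_distrib_right of_real_sum)
    finally show ?thesis by (simp only: c of_real_1 mult_1)
  qed
  then show ?thesis by (simp add: schrodinger_solution_def Bdef)
qed

section \<open>Levels of the 4-cube and of the switched 4-cube\<close>

text \<open>
  The distance from vertex 1 in the 4-cube and in the switched 4-cube alike; the argument is the row
  index, one less than the vertex number.
\<close>

definition level :: "nat \<Rightarrow> nat" where
  "level a = (if a = 0 then 0 else if a < 5 then 1 else if a < 11 then 2 else if a < 15 then 3 else 4)"

text \<open>The levels form an equitable partition with the quotient of the 4-cube:
  \<open>level a\<close> neighbours one level down, \<open>4 - level a\<close> one level up. At the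
  two ends the arguments \<open>0 - 1 = 0\<close> and \<open>5\<close> are harmless, as their
  coefficients are 0.\<close>

definition regular_on_levels :: "real mat \<Rightarrow> bool" where
  "regular_on_levels M \<longleftrightarrow> M \<in> carrier_mat 16 16 \<and> (\<forall>(g :: nat \<Rightarrow> complex). \<forall>a<16.
     (\<Sum>b<16. of_real (M $$ (a, b)) * g (level b)) =
       of_nat (level a) * g (level a - 1) + of_nat (4 - level a) * g (level a + 1))"

lemma lessThan_16: "{..<16::nat} = {0,1,2,3,4,5,6,7,8,9,10,11,12,13,14,15}"
  by (simp add: set_eq_iff) presburger

lemma regular_on_levels_A41: "regular_on_levels A41"
proof -
  have "(\<Sum>b<16. of_real (A41 $$ (a, b)) * g (level b)) =
       of_nat (level a) * g (level a - 1) + of_nat (4 - level a) * g (level a + 1)"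
    if "a < 16" for a and g :: "nat \<Rightarrow> complex"
  proof -
    have "a \<in> {..<16}" using that by simp
    then show ?thesis
      unfolding lessThan_16
      \<comment> \<open>Sixteen row computations with \<open>g\<close> symbolic; the last rule
        writes level 2 as \<open>2\<close> instead of \<open>Suc (Suc 0)\<close>, so that the
        arguments of \<open>g\<close> match.\<close>
      by (elim insertE emptyE)
        (simp_all add: A41_def adj_of_edges_def outer_edges_def level_def doubleton_eq_iff
          numeral_2_eq_2[symmetric])
  qed
  then show ?thesis by (simp add: regular_on_levels_def A41_def adj_of_edges_def)
qed

text \<open>In the 4-cube a level-1 vertex meets 3 of the 6 vertices of level 2, and a level-2
  vertex meets 2 of the 4 vertices of level 1. Both are exactly half, so the bipartite complement
  has the same degrees.\<close>

lemma regular_on_levels_A42: "regular_on_levels A42"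
proof -
  have "(\<Sum>b<16. of_real (A42 $$ (a, b)) * g (level b)) =
       of_nat (level a) * g (level a - 1) + of_nat (4 - level a) * g (level a + 1)"
    if "a < 16" for a and g :: "nat \<Rightarrow> complex"
  proof -
    have "a \<in> {..<16}" using that by simp
    then show ?thesis
      unfolding lessThan_16
      by (elim insertE emptyE)
        (simp_all add: A42_def adj_of_edges_def outer_edges_def level_def doubleton_eq_iff
          numeral_2_eq_2[symmetric])
  qed
  then show ?thesis by (simp add: regular_on_levels_def A42_def adj_of_edges_def)
qed

lemma regular_on_levels_mixture:
  assumes A: "regular_on_levels A" and B: "regular_on_levels B"
  shows "regular_on_levels (p \<cdot>\<^sub>m A + (1 - p) \<cdot>\<^sub>m B)"
proof -
  have c: "A \<in> carrier_mat 16 16" "B \<in> carrier_mat 16 16"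
    using assms by (auto simp: regular_on_levels_def)
  have "(\<Sum>b<16. of_real ((p \<cdot>\<^sub>m A + (1 - p) \<cdot>\<^sub>m B) $$ (a, b)) * g (level b)) =
       of_nat (level a) * g (level a - 1) + of_nat (4 - level a) * g (level a + 1)"
    if a: "a < 16" for a and g :: "nat \<Rightarrow> complex"
  proof -
    have "(\<Sum>b<16. of_real ((p \<cdot>\<^sub>m A + (1 - p) \<cdot>\<^sub>m B) $$ (a, b)) * g (level b)) =
        of_real p * (\<Sum>b<16. of_real (A $$ (a, b)) * g (level b)) +
        of_real (1 - p) * (\<Sum>b<16. of_real (B $$ (a, b)) * g (level b))"
      unfolding sum_distrib_left sum.distrib[symmetric]
      using a c by (intro sum.cong) (simp_all add: algebra_simps)
    also have "\<dots> = of_nat (level a) * g (level a - 1) + of_nat (4 - level a) * g (level a + 1)"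
      using assms a by (simp add: regular_on_levels_def algebra_simps)
    finally show ?thesis .
  qed
  then show ?thesis using c by (simp add: regular_on_levels_def)
qed

section \<open>Block structure of the adjacency matrices\<close>

lemma block_index_less:
  fixes a b :: nat
  assumes "a < s" "b < r" shows "a + b * s < r * s"
proof -
  have "a + b * s < Suc b * s" using assms by simp
  also have "\<dots> \<le> r * s" using assms by (intro mult_right_mono) auto
  finally show ?thesis .
qed

lemma dim_diag_block_mat_uniform:
  assumes "\<forall>B \<in> set Bs. B \<in> carrier_mat s s"
  shows "diag_block_mat Bs \<in> carrier_mat (length Bs * s) (length Bs * s)"
  using assms by (induction Bs) (auto simp: Let_def)

lemma index_diag_block_mat_uniform:
  assumes "\<forall>B \<in> set Bs. B \<in> carrier_mat s s" "b < length Bs" "b' < length Bs" "a < s" "a' < s"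
  shows "diag_block_mat Bs $$ (a + b * s, a' + b' * s) = (if b = b' then (Bs ! b) $$ (a, a') else 0)"
  using assms
proof (induction Bs arbitrary: b b')
  case Nil
  then show ?case by simp
next
  case (Cons B Bs)
  have D: "diag_block_mat Bs \<in> carrier_mat (length Bs * s) (length Bs * s)"
    using Cons.prems by (intro dim_diag_block_mat_uniform) simp
  have B: "B \<in> carrier_mat s s" using Cons.prems by simp
  have less: "a + b * s < s + length Bs * s" "a' + b' * s < s + length Bs * s"
    using block_index_less[of a s b "length (B # Bs)"] block_index_less[of a' s b' "length (B # Bs)"]
      Cons.prems by simp_all
  have lessI: "a + c * s < length Bs * s" "a' + c * s < length Bs * s" if "c < length Bs" for c
    using block_index_less that Cons.prems by blast+
  show ?case
    using Cons.prems Cons.IH B D less lessI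
    by (cases b; cases b') (simp_all add: Let_def)
qed

text \<open>A common entrywise form for the Kronecker and the block-diagonal presentations: in the
  index \<open>a + b * 16\<close>, \<open>b\<close> is the vertex of the \<open>m\<close>-cube and
  \<open>a\<close> the position within its block.\<close>

definition block_cube :: "nat \<Rightarrow> (nat \<Rightarrow> real mat) \<Rightarrow> real mat \<Rightarrow> bool" where
  "block_cube m M A \<longleftrightarrow> A \<in> carrier_mat (2 ^ m * 16) (2 ^ m * 16) \<and>
     (\<forall>b<2 ^ m. \<forall>b'<2 ^ m. \<forall>a<16. \<forall>a'<16. A $$ (a + b * 16, a' + b' * 16) =
        (if b = b' then M b $$ (a, a') else 0) + (if a = a' then cube_adj m $$ (b, b') else 0))"

lemma block_cube_kron:
  assumes "B \<in> carrier_mat 16 16"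
  shows "block_cube m (\<lambda>_. B) (cube_adj m \<otimes>\<^sub>K 1\<^sub>m 16 + 1\<^sub>m (2 ^ m) \<otimes>\<^sub>K B)"
  using assms by (auto simp: block_cube_def kron_def cube_adj_def block_index_less)

lemma block_cube_diag:
  assumes "\<forall>B \<in> set Bs. B \<in> carrier_mat 16 16" "length Bs = 2 ^ m"
  shows "block_cube m ((!) Bs) (diag_block_mat Bs + cube_adj m \<otimes>\<^sub>K 1\<^sub>m 16)"
  using assms index_diag_block_mat_uniform[OF assms(1)] dim_diag_block_mat_uniform[OF assms(1)]
  by (auto simp: block_cube_def kron_def cube_adj_def block_index_less)

section \<open>Neighbours in the cube as bit flips\<close>

lemma bit_less_exp_imp_less:
  fixes b :: nat
  assumes "b < 2 ^ m" "bit b k" shows "k < m"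
proof -
  have "bit (take_bit m b) k" using assms by (simp add: take_bit_nat_eq_self)
  then show ?thesis by (simp add: bit_take_bit_iff)
qed

lemma flip_bit_less_exp: "k < m \<Longrightarrow> b < 2 ^ m \<Longrightarrow> flip_bit k b < (2::nat) ^ m"
  by (metis take_bit_flip_bit_eq not_le take_bit_nat_eq_self take_bit_nat_less_exp)

text \<open>Two numbers below \<open>2 ^ m\<close> can differ only at positions below
  \<open>m\<close>, so the single differing bit is one of the \<open>m\<close> directions.\<close>

lemma cube_neighbours:
  fixes b :: nat
  assumes b: "b < 2 ^ m"
  shows "{c. c < 2 ^ m \<and> card {k. bit b k \<noteq> bit c k} = 1} = (\<lambda>k. flip_bit k b) ` {..<m}"
proof (intro equalityI subsetI)
  fix c :: nat assume "c \<in> {c. c < 2 ^ m \<and> card {k. bit b k \<noteq> bit c k} = 1}"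
  then have c: "c < 2 ^ m" and "card {k. bit b k \<noteq> bit c k} = 1" by simp_all
  then obtain k where k: "{k. bit b k \<noteq> bit c k} = {k}" using card_1_singletonE by metis
  have "bit c j = bit (flip_bit k b) j" for j
    using arg_cong[OF k, of "\<lambda>X. j \<in> X"] by (simp add: bit_flip_bit_iff) blast
  then have "c = flip_bit k b" by (simp add: bit_eq_iff)
  moreover have "bit b k \<noteq> bit c k" using k by blast
  then have "k < m" using bit_less_exp_imp_less[OF b] bit_less_exp_imp_less[OF c] by blast
  ultimately show "c \<in> (\<lambda>k. flip_bit k b) ` {..<m}" by simp
next
  fix c assume "c \<in> (\<lambda>k. flip_bit k b) ` {..<m}"
  then obtain k where k: "k < m" "c = flip_bit k b" by blast
  have "{j. bit b j \<noteq> bit c j} = {k}" unfolding k by (auto simp: bit_flip_bit_iff)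
  then show "c \<in> {c. c < 2 ^ m \<and> card {k. bit b k \<noteq> bit c k} = 1}"
    using flip_bit_less_exp[OF k(1) b] k(2) by simp
qed

lemma inj_flip_bit: "inj (\<lambda>k. flip_bit k (b::nat))"
proof (rule injI)
  fix k l assume "flip_bit k b = flip_bit l b"
  then have "bit (flip_bit k b) k = bit (flip_bit l b) k" by simp
  then show "k = l" by (auto simp: bit_flip_bit_iff)
qed

lemma sum_cube_adj:
  fixes f :: "nat \<Rightarrow> complex"
  assumes b: "b < 2 ^ m"
  shows "(\<Sum>c<2 ^ m. of_real (cube_adj m $$ (b, c)) * f c) = (\<Sum>k<m. f (flip_bit k b))"
proof -
  have "(\<Sum>c<2 ^ m. of_real (cube_adj m $$ (b, c)) * f c) =
      (\<Sum>c<2 ^ m. if card {k. bit b k \<noteq> bit c k} = 1 then f c else 0)"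
    using b by (intro sum.cong) (simp_all add: cube_adj_def)
  also have "\<dots> = sum f {c. c < 2 ^ m \<and> card {k. bit b k \<noteq> bit c k} = 1}"
    by (subst sum.inter_filter[symmetric]) simp_all
  finally show ?thesis
    unfolding cube_neighbours[OF b] by (simp add: sum.reindex inj_on_subset[OF inj_flip_bit])
qed

text \<open>On a product of a function of the block and a function of the level, the cube part acts
  on the first factor and the diagonal blocks on the second. The result no longer contains
  \<open>M\<close>: here all the systems become indistinguishable.\<close>

lemma sum_block_cube:
  fixes f g :: "nat \<Rightarrow> complex"
  assumes A: "block_cube m M A" and M: "regular_on_levels (M b)" and b: "b < 2 ^ m" and a: "a < 16"
  shows "(\<Sum>j<2 ^ m * 16. of_real (A $$ (a + b * 16, j)) * (f (j div 16) * g (level (j mod 16)))) =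
      (\<Sum>k<m. f (flip_bit k b)) * g (level a) +
      f b * (of_nat (level a) * g (level a - 1) + of_nat (4 - level a) * g (level a + 1))"
proof -
  have "(\<Sum>j<2 ^ m * 16. of_real (A $$ (a + b * 16, j)) * (f (j div 16) * g (level (j mod 16)))) =
      (\<Sum>b'<2 ^ m. \<Sum>a'<16. of_real (A $$ (a + b * 16, a' + b' * 16)) * (f b' * g (level a')))"
    unfolding sum_mult_product by (intro sum.cong) simp_all
  also have "\<dots> = (\<Sum>b'<2 ^ m. \<Sum>a'<16.
      (if b = b' then f b * (of_real (M b $$ (a, a')) * g (level a')) else 0) +
      (if a = a' then of_real (cube_adj m $$ (b, b')) * f b' * g (level a) else 0))"
    using A b a by (intro sum.cong refl) (auto simp: block_cube_def algebra_simps)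
  also have "\<dots> = (\<Sum>b'<2 ^ m. (if b = b' then f b * (\<Sum>a'<16. of_real (M b $$ (a, a')) * g (level a')) else 0) +
      of_real (cube_adj m $$ (b, b')) * f b' * g (level a))"
    using a by (intro sum.cong refl) (auto simp: sum.distrib sum_distrib_left)
  also have "\<dots> = f b * (\<Sum>a'<16. of_real (M b $$ (a, a')) * g (level a')) +
      (\<Sum>b'<2 ^ m. of_real (cube_adj m $$ (b, b')) * f b') * g (level a)"
    using b by (simp add: sum.distrib sum_distrib_right)
  also have "(\<Sum>a'<16. of_real (M b $$ (a, a')) * g (level a')) =
      of_nat (level a) * g (level a - 1) + of_nat (4 - level a) * g (level a + 1)"
    using M a by (simp add: regular_on_levels_def)
  finally show ?thesis
    by (simp add: sum_cube_adj[OF b])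
qed

section \<open>The explicit trajectory\<close>

text \<open>The entries of \<open>exp (\<i> z X)\<close> for the adjacency matrix \<open>X\<close> of an edge.\<close>

definition bit_amplitude :: "bool \<Rightarrow> complex \<Rightarrow> complex" where
  "bit_amplitude e z = (if e then cos z else \<i> * sin z)"

lemma bit_amplitude_deriv:
  "((\<lambda>z. bit_amplitude e z) has_field_derivative \<i> * bit_amplitude (\<not> e) z) (at z)"
  by (cases e) (auto simp: bit_amplitude_def intro!: derivative_eq_intros)

text \<open>The entry at \<open>(b, x)\<close> of the exponential of \<open>\<i> z\<close> times the
  \<open>m\<close>-cube matrix: the bits evolve independently, so it is a product over bits.\<close>

definition cube_amplitude :: "nat \<Rightarrow> nat \<Rightarrow> nat \<Rightarrow> complex \<Rightarrow> complex" where
  "cube_amplitude m x b z = (\<Prod>k<m. bit_amplitude (bit b k = bit x k) z)"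

text \<open>In the product rule, differentiating factor \<open>k\<close> turns agreement of
  \<open>b\<close> and \<open>x\<close> in bit \<open>k\<close> into disagreement and vice versa,
  which amounts to flipping that bit of \<open>b\<close>.\<close>

lemma cube_amplitude_deriv:
  "((\<lambda>z. cube_amplitude m x b z) has_field_derivative
    \<i> * (\<Sum>k<m. cube_amplitude m x (flip_bit k b) z)) (at z)"
proof -
  have "cube_amplitude m x (flip_bit k b) z = bit_amplitude (\<not> (bit b k = bit x k)) z *
      (\<Prod>j\<in>{..<m} - {k}. bit_amplitude (bit b j = bit x j) z)" if "k < m" for k
  proof -
    have "(\<Prod>j\<in>{..<m} - {k}. bit_amplitude (bit (flip_bit k b) j = bit x j) z) =
        (\<Prod>j\<in>{..<m} - {k}. bit_amplitude (bit b j = bit x j) z)"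
      by (intro prod.cong) (auto simp: bit_flip_bit_iff)
    then show ?thesis
      unfolding cube_amplitude_def using that
      by (subst prod.remove[of _ k]; cases "bit b k"; simp add: bit_flip_bit_iff)
  qed
  then show ?thesis
    unfolding cube_amplitude_def
    by (intro DERIV_cong[OF has_field_derivative_prod[OF bit_amplitude_deriv]])
      (simp add: sum_distrib_left mult.assoc cube_amplitude_def)
qed

text \<open>A vertex of the 4-cube at level \<open>l\<close> agrees with vertex 1 in
  \<open>4 - l\<close> bits and differs in \<open>l\<close>; relative to vertex 16 the two counts
  are exchanged, hence the role of \<open>e\<close>.\<close>

definition level_amplitude :: "bool \<Rightarrow> nat \<Rightarrow> complex \<Rightarrow> complex" where
  "level_amplitude e l z = bit_amplitude e z ^ (4 - l) * bit_amplitude (\<not> e) z ^ l"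

lemma level_amplitude_deriv:
  assumes "l \<le> 4"
  shows "((\<lambda>z. level_amplitude e l z) has_field_derivative
    \<i> * (of_nat l * level_amplitude e (l - 1) z + of_nat (4 - l) * level_amplitude e (l + 1) z)) (at z)"
proof -
  \<comment> \<open>Checking each level separately settles the truncated subtractions in the
    exponents, notably at 0 and 4.\<close>
  have l: "l \<in> {0, 1, 2, 3, 4}" using assms by auto
  show ?thesis
    unfolding level_amplitude_def
    by (rule derivative_eq_intros bit_amplitude_deriv refl)+
      (use l in \<open>auto simp: eval_nat_numeral algebra_simps\<close>)
qed

text \<open>
  The state that starts in block \<open>x\<close>, at its vertex 1 if \<open>e\<close> holds and at its vertex 16 otherwise.
\<close>

definition amplitude :: "nat \<Rightarrow> nat \<Rightarrow> bool \<Rightarrow> complex \<Rightarrow> complex vec" where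
  "amplitude m x e z = vec (2 ^ m * 16)
     (\<lambda>i. cube_amplitude m x (i div 16) z * level_amplitude e (level (i mod 16)) z)"

lemma level_le: "level a \<le> 4"
  by (simp add: level_def)

lemma amplitude_deriv:
  assumes i: "i < 2 ^ m * 16"
  shows "((\<lambda>z. amplitude m x e z $ i) has_field_derivative
    \<i> * ((\<Sum>k<m. cube_amplitude m x (flip_bit k (i div 16)) z) * level_amplitude e (level (i mod 16)) z +
      cube_amplitude m x (i div 16) z *
        (of_nat (level (i mod 16)) * level_amplitude e (level (i mod 16) - 1) z +
         of_nat (4 - level (i mod 16)) * level_amplitude e (level (i mod 16) + 1) z))) (at z)"
  using i unfolding amplitude_def
  by (auto intro!: DERIV_cong[OF DERIV_mult[OF cube_amplitude_deriv level_amplitude_deriv[OF level_le]]]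
      simp: algebra_simps)

text \<open>The product rule for \<open>amplitude\<close> yields the same two terms as
  \<open>sum_block_cube\<close>, up to the factor \<open>\<i>\<close>.\<close>

lemma amplitude_schrodinger_solution:
  assumes A: "block_cube m M A" and M: "\<forall>b<2 ^ m. regular_on_levels (M b)"
  shows "schrodinger_solution (2 ^ m * 16) (amplitude m x e) A"
proof -
  have "(\<Sum>j<2 ^ m * 16. of_real (A $$ (i, j)) * amplitude m x e z $ j) =
      - \<i> * deriv (\<lambda>z. amplitude m x e z $ i) z" if i: "i < 2 ^ m * 16" for i z
  proof -
    have b: "i div 16 < 2 ^ m" using i by (simp add: less_mult_imp_div_less)
    have "(\<Sum>j<2 ^ m * 16. of_real (A $$ (i, j)) * amplitude m x e z $ j) =
        (\<Sum>j<2 ^ m * 16. of_real (A $$ (i mod 16 + i div 16 * 16, j)) *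
          (cube_amplitude m x (j div 16) z * level_amplitude e (level (j mod 16)) z))"
      by (intro sum.cong) (simp_all add: amplitude_def)
    then show ?thesis
      using sum_block_cube[OF A _ b, of "i mod 16" "\<lambda>b. cube_amplitude m x b z" "\<lambda>l. level_amplitude e l z"] M b
      by (simp add: DERIV_imp_deriv[OF amplitude_deriv[OF i]])
  qed
  then show ?thesis using A by (simp add: schrodinger_solution_def block_cube_def)
qed

lemma all_n_cube_graphs_schrodinger_solution:
  assumes "A \<in> all_n_cube_graphs (m + 4)"
  shows "schrodinger_solution (2 ^ m * 16) (amplitude m x e) A"
proof -
  note reg = regular_on_levels_A41 regular_on_levels_A42
  have carr: "B \<in> carrier_mat 16 16" if "regular_on_levels B" for B
    using that by (simp add: regular_on_levels_def)
  have diag: "schrodinger_solution (2 ^ m * 16) (amplitude m x e)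
      (diag_block_mat Bs + cube_adj m \<otimes>\<^sub>K 1\<^sub>m 16)"
    if "\<forall>B \<in> set Bs. regular_on_levels B" "length Bs = 2 ^ m" for Bs
    using that by (intro amplitude_schrodinger_solution[OF block_cube_diag]) (auto intro: carr)
  have graphs: "\<forall>A \<in> n_cube_graphs (m + 4). schrodinger_solution (2 ^ m * 16) (amplitude m x e) A"
    unfolding n_cube_graphs_def n_cube_def switched_n_cube_def partially_switched_n_cubes_def
    using reg
    by (auto intro!: diag amplitude_schrodinger_solution[OF block_cube_kron] carr)
  moreover have "\<forall>A \<in> blockwise_mixed_n_cubes (m + 4).
      schrodinger_solution (2 ^ m * 16) (amplitude m x e) A"
    unfolding blockwise_mixed_n_cubes_def
    using reg by (auto intro!: diag regular_on_levels_mixture)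
  ultimately have "\<forall>A \<in> n_cube_graphs (m + 4) \<union> blockwise_mixed_n_cubes (m + 4).
      schrodinger_solution (2 ^ m * 16) (amplitude m x e) A"
    by blast
  from schrodinger_solution_convex_combination[OF this] graphs show ?thesis
    using assms by (auto simp: all_n_cube_graphs_def weighted_n_cube_graphs_def power_add)
qed

lemma amplitude_0:
  assumes x: "x < 2 ^ m"
  shows "amplitude m x e 0 = unit_vec (2 ^ m * 16) (x * 16 + (if e then 0 else 15))"
proof
  fix i assume "i < dim_vec (unit_vec (2 ^ m * 16) (x * 16 + (if e then 0 else 15)) :: complex vec)"
  then have i: "i < 2 ^ m * 16" by simp
  then have b: "i div 16 < 2 ^ m" by (simp add: less_mult_imp_div_less)
  have "cube_amplitude m x (i div 16) 0 = (if i div 16 = x then 1 else 0)"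
  proof (cases "i div 16 = x")
    case False
    \<comment> \<open>Truncating to \<open>m\<close> bits ensures that the distinguishing bit lies
      below \<open>m\<close>, where it makes a factor of the product vanish at 0.\<close>
    have "take_bit m (i div 16) \<noteq> take_bit m x"
      using False x b by (simp add: take_bit_nat_eq_self)
    then have "\<exists>k<m. bit (i div 16) k \<noteq> bit x k"
      by (auto simp: bit_eq_iff bit_take_bit_iff)
    then show ?thesis using False by (auto simp: cube_amplitude_def bit_amplitude_def)
  qed (simp add: cube_amplitude_def bit_amplitude_def)
  moreover have "level_amplitude e (level (i mod 16)) 0 =
      (if i mod 16 = (if e then 0 else 15) then 1 else 0)"
    using mod_less_divisor[of 16 i]
    by (auto simp: level_amplitude_def bit_amplitude_def level_def)
  moreover have "i = x * 16 + c \<longleftrightarrow> i div 16 = x \<and> i mod 16 = c" if "c < 16" for c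
    using that by auto
  ultimately show "amplitude m x e 0 $ i = unit_vec (2 ^ m * 16) (x * 16 + (if e then 0 else 15)) $ i"
    using i x by (auto simp: amplitude_def unit_vec_def)
qed (simp add: amplitude_def)

text \<open>All \<open>m + 4\<close> bits differ from those of the starting vertex, and each
  contributes a factor \<open>\<i> * sin z\<close>.\<close>

lemma amplitude_antipode:
  assumes "y < 2 ^ m" "\<forall>k<m. bit x k \<noteq> bit y k"
  shows "amplitude m x e z $ (y * 16 + (if e then 15 else 0)) = (\<i> * sin z) ^ (m + 4)"
  using assms block_index_less[of "if e then 15 else 0" 16 y "2 ^ m"]
  by (auto simp: amplitude_def cube_amplitude_def level_amplitude_def bit_amplitude_def level_def
      power_add add.commute)

section \<open>Antipodal vertices and the fidelity\<close>

text \<open>Proved over the integers, where \<open>2 ^ m - 1 - y\<close> is the truncation of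
  \<open>NOT y\<close> to \<open>m\<close> bits.\<close>

lemma bit_complement_nat:
  includes bit_operations_syntax
  fixes y :: nat
  assumes "y < 2 ^ m" "k < m"
  shows "bit (2 ^ m - 1 - y) k \<noteq> bit y k"
proof -
  have "int y < 2 ^ m" using assms by (metis of_nat_less_iff of_nat_numeral of_nat_power)
  then have "take_bit m (NOT (int y)) = 2 ^ m - 1 - int y"
    unfolding take_bit_not_eq_mask_diff mask_eq_exp_minus_1
    by (subst take_bit_int_eq_self) simp_all
  also have "\<dots> = int (2 ^ m - 1 - y)" using assms by (simp add: of_nat_diff)
  finally have "int (2 ^ m - 1 - y) = take_bit m (NOT (int y))" ..
  then have "bit (int (2 ^ m - 1 - y)) k \<longleftrightarrow> \<not> bit (int y) k"
    using assms by (simp add: bit_take_bit_iff bit_not_iff)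
  then show ?thesis by (simp add: bit_of_nat_iff_bit)
qed

lemma S_antipode:
  assumes u: "u \<in> S (m + 4)" and v: "v = 2 ^ (m + 4) + 1 - u"
  obtains x y e where "x < 2 ^ m" "y < 2 ^ m" "\<forall>k<m. bit x k \<noteq> bit y k"
    "u - 1 = y * 16 + (if e then 15 else 0)" "v - 1 = x * 16 + (if e then 0 else 15)"
proof -
  obtain a \<mu> where a: "a \<in> {1, 16}" and u_eq: "u = a + (\<Sum>k = 4..<m + 4. 2 ^ k * \<mu> k)"
    and \<mu>: "\<forall>k. \<mu> k \<in> {0, 1}"
    using u unfolding S_def by blast
  define y where "y = (\<Sum>k<m. 2 ^ k * \<mu> (k + 4))"
  have "(\<Sum>k = 4..<m + 4. 2 ^ k * \<mu> k) = y * 16"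
    using sum.shift_bounds_nat_ivl[of "\<lambda>k. 2 ^ k * \<mu> k" 0 4 m]
    by (simp add: y_def atLeast0LessThan sum_distrib_left power_add mult_ac)
  then have u': "u = a + y * 16" using u_eq by simp
  have y: "y < 2 ^ m"
  proof -
    have "(\<Sum>k<m. 2 ^ k * \<mu> (k + 4)) < 2 ^ m"
    proof (induction m)
      case (Suc m)
      have "\<mu> (m + 4) \<le> 1" using \<mu> by (metis insert_iff le_numeral_extra(4) singletonD zero_le)
      then have "2 ^ m * \<mu> (m + 4) \<le> 2 ^ m" by simp
      with Suc have "(\<Sum>k<m. 2 ^ k * \<mu> (k + 4)) + 2 ^ m * \<mu> (m + 4) < 2 ^ m + 2 ^ m"
        by (intro add_less_le_mono)
      then show ?case by simp
    qed simp
    then show ?thesis by (simp add: y_def)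
  qed
  show thesis
  \<comment> \<open>The indices \<open>u - 1\<close> and \<open>v - 1\<close> add up to
    \<open>2 ^ (m + 4) - 1\<close>, so they are bitwise complements: complementary blocks and
    opposite ends of the 4-cube. The trajectory will start at \<open>v\<close>, hence
    \<open>e\<close> says that \<open>v\<close> is vertex 1 of its block.\<close>
  proof (rule that[of "2 ^ m - 1 - y" y "a = 16"])
    show "\<forall>k<m. bit (2 ^ m - 1 - y) k \<noteq> bit y k" using bit_complement_nat[OF y] by blast
    show "v - 1 = (2 ^ m - 1 - y) * 16 + (if a = 16 then 0 else 15)"
      using a y by (auto simp: v u' power_add diff_mult_distrib)
  qed (use y a u' in auto)
qed

text \<open>This covers every real \<open>t\<close>: before the last switching time the formal
  product has a last factor of negative duration, which follows the trajectory backwards.\<close>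

lemma system_fidelities_eq:
  assumes u: "u \<in> S (m + 4)" and v: "v = 2 ^ (m + 4) + 1 - u"
    and p: "p \<in> system_fidelities (m + 4) u v"
  shows "p t = sin t ^ (2 * (m + 4))"
proof -
  obtain x y e where x: "x < 2 ^ m" and y: "y < 2 ^ m" and xy: "\<forall>k<m. bit x k \<noteq> bit y k"
    and u1: "u - 1 = y * 16 + (if e then 15 else 0)" and v1: "v - 1 = x * 16 + (if e then 0 else 15)"
    using S_antipode[OF u v] .
  let ?N = "2 ^ m * 16 :: nat" and ?\<phi> = "amplitude m x e"
  have \<phi>: "?\<phi> z \<in> carrier_vec ?N" for z by (simp add: amplitude_def)
  have hol: "(\<lambda>z. ?\<phi> z $ i) holomorphic_on UNIV" if "i < ?N" for i
    using amplitude_deriv[OF that] by (meson field_differentiable_at_within field_differentiable_def holomorphic_onI)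
  have u1_less: "u - 1 < ?N"
    using y u1 by auto
  have prob: "transfer_prob U u v = sin t ^ (2 * (m + 4))"
    if U: "U \<in> carrier_mat ?N ?N" and "U *\<^sub>v ?\<phi> (of_real 0) = ?\<phi> (of_real t)" for U
  proof -
    \<comment> \<open>The bra is a real vector, so the conjugation in \<open>\<bullet>c\<close>
      leaves it unchanged and the overlap is a coordinate.\<close>
    have conj: "conjugate (ket ?N u) = ket ?N u"
      by (intro eq_vecI) (simp_all add: ket_def unit_vec_def)
    have "U *\<^sub>v ket ?N v = ?\<phi> (of_real t)"
      using that amplitude_0[OF x, of e] by (simp add: ket_def v1[simplified])
    moreover have "?\<phi> (of_real t) \<bullet>c ket ?N u = ?\<phi> (of_real t) $ (u - 1)"
      unfolding conj using u1_less \<phi>[of t] by (simp add: ket_def)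
    ultimately have "transfer_prob U u v = (cmod ((\<i> * sin (of_real t)) ^ (m + 4)))\<^sup>2"
      using U amplitude_antipode[OF y xy, of e t] by (simp add: transfer_prob_def u1[simplified])
    also have "cmod ((\<i> * sin (of_real t)) ^ (m + 4)) = \<bar>sin t\<bar> ^ (m + 4)"
      by (simp add: norm_power norm_mult sin_of_real)
    also have "(\<bar>sin t\<bar> ^ (m + 4))\<^sup>2 = sin t ^ ((m + 4) * 2)"
      unfolding power_mult[symmetric] by (rule power_even_abs) simp
    finally show ?thesis by (simp only: mult.commute)
  qed
  note sol = all_n_cube_graphs_schrodinger_solution[of _ m x e]
  from p consider A where "p = fidelity A u v" "A \<in> all_n_cube_graphs (m + 4)"
    | ts As where "p = switched_fidelity (2 ^ (m + 4)) ts As u v" "switching_schedule (m + 4) ts As"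
    unfolding system_fidelities_def by blast
  then show ?thesis
  proof cases
    case 1
    have "A \<in> carrier_mat ?N ?N" using sol[OF 1(2)] by (simp add: schrodinger_solution_def)
    then show ?thesis
      using prob[OF evolution_carrier] evolution_schrodinger_solution[OF sol[OF 1(2)] \<phi> hol, of t 0]
      by (simp add: 1 fidelity_def)
  next
    case 2
    then have As: "\<forall>A \<in> set As. schrodinger_solution ?N ?\<phi> A"
      and ts: "length As = length ts" "ts \<noteq> []" "hd ts = 0"
      using sol by (auto simp: switching_schedule_def)
    have "\<forall>A \<in> set As. A \<in> carrier_mat ?N ?N" using As by (simp add: schrodinger_solution_def)
    then show ?thesis
      using prob[OF switched_evolution_carrier]
        switched_evolution_schrodinger_solution[OF As \<phi> hol ts(1,2), of t 0] ts(3)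
      by (simp add: 2 switched_fidelity_def power_add)
  qed
qed

section \<open>Smoothness and the conclusion\<close>

text \<open>Along the real axis, taking real parts commutes with differentiation, so real
  derivatives of every order are inherited from the entire function.\<close>

lemma higher_deriv_Re:
  fixes F :: "complex \<Rightarrow> complex"
  assumes "F holomorphic_on UNIV"
  shows "(deriv ^^ k) (\<lambda>t. Re (F (of_real t))) = (\<lambda>t. Re ((deriv ^^ k) F (of_real t)))"
    and "(\<lambda>t. Re ((deriv ^^ k) F (of_real t))) differentiable (at t)"
proof -
  have D: "((\<lambda>t. Re ((deriv ^^ k) F (of_real t))) has_real_derivative
      Re ((deriv ^^ Suc k) F (of_real t))) (at t)" for k t
  proof -
    have "((deriv ^^ k) F has_field_derivative (deriv ^^ Suc k) F (of_real t)) (at (of_real t))"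
      using holomorphic_higher_deriv[OF assms open_UNIV, of k] by (simp add: holomorphic_derivI)
    from has_field_derivative_Re[OF has_vector_derivative_real_field[OF this]]
    show ?thesis .
  qed
  show "(deriv ^^ k) (\<lambda>t. Re (F (of_real t))) = (\<lambda>t. Re ((deriv ^^ k) F (of_real t)))"
    by (induction k) (use DERIV_imp_deriv[OF D] in auto)
  show "(\<lambda>t. Re ((deriv ^^ k) F (of_real t))) differentiable (at t)"
    using D real_differentiable_def by blast
qed

lemma smooth_at_sin_power: "smooth_at (\<lambda>t. sin t ^ j) x"
proof -
  let ?F = "\<lambda>z :: complex. sin z ^ j"
  have eq: "(\<lambda>t. sin t ^ j) = (\<lambda>t. Re (?F (of_real t)))"
    by (simp add: sin_of_real flip: of_real_power)
  have "?F holomorphic_on UNIV" by (intro holomorphic_intros)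
  then show ?thesis
    unfolding smooth_at_def eq by (simp add: higher_deriv_Re[where F = ?F])
qed

theorem theorem14:
  fixes n u v :: nat
  assumes "n \<ge> 4" and "u \<in> S n" and "v = 2 ^ n + 1 - u"
  shows "(\<forall>p \<in> system_fidelities n u v. p (pi / 2) = 1 \<and> smooth_at p (pi / 2)) \<and>
         (\<forall>p \<in> system_fidelities n u v. \<forall>q \<in> system_fidelities n u v. \<forall>k \<ge> 1.
            (deriv ^^ k) p (pi / 2) = (deriv ^^ k) q (pi / 2))"
proof -
  obtain m where n: "n = m + 4" using assms(1) by (metis le_add_diff_inverse2)
  \<comment> \<open>Equality as functions, not only at \<open>pi / 2\<close>, makes the derivatives
    of every order agree.\<close>
  have "p = (\<lambda>t. sin t ^ (2 * n))" if "p \<in> system_fidelities n u v" for p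
    using system_fidelities_eq[of u m v p] that assms n by auto
  then show ?thesis using smooth_at_sin_power by (metis sin_pi_half power_one)
qed

end
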